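(* For any $x$ and all integers $n \geq 0$, $$\binom{x}{n} = \sum_{i=1}^{n} \binom{x-n+i}{i}\binom{x}{n-i}\binom{n}{i}\binom{2n-1}{i}^{-1}(-1)^{i+1} + [n=0].$$
   Context: $x$ is an indeterminate (or an arbitrary number), $\binom{y}{k} = y(y-1)\cdots(y-k+1)/k!$ for integers $k\ge 0$, and $[n=0]$ equals $1$ if $n=0$ and $0$ otherwise. The sum is empty when $n=0$. *)

theory Defs
  imports Complex_Main
begin

end

theory Submission
  imports Defs "HOL-Computational_Algebra.Formal_Power_Series"
begin

text \<open>
  For \<open>n > 0\<close>, move \<open>x gchoose n\<close> to the other side: it is minus the term \<open>i = 0\<close> of the sum, so the
  claim is that the alternating sum over \<open>0 \<le> i \<le> n\<close> vanishes. The dependence on \<open>x\<close> is illusory,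
  because the falling factorial of length \<open>n\<close> splits after \<open>n - i\<close> factors
  (trinomial revision), which turns the two factors containing \<open>x\<close> into
  \<open>(x gchoose n) * (n choose i)\<close>. What remains is the numerical identity
  \<open>(\<Sum>i\<le>n. (-1)^i * (n choose i)\<^sup>2 / ((2n-1) choose i)) = 0\<close>, proved in
  \<open>alternating_sum_binomial_square_quotient\<close>: a second trinomial revision removes the denominator,
  negating an upper index absorbs the signs, and Vandermonde's convolution evaluates the
  sum as a multiple of \<open>(n + (-n)) gchoose n = 0\<close>.
\<close>

lemma gbinomial_product_eq_gbinomial_times_binomial:
  fixes x :: "'a :: field_char_0"
  assumes "i \<le> n"
  shows "((x - of_nat n + of_nat i) gchoose i) * (x gchoose (n - i))
    = (x gchoose n) * of_nat (n choose i)"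
proof -
  have "(x gchoose n) * of_nat (n choose i) = (x gchoose n) * (of_nat n gchoose (n - i))"
    by (simp only: binomial_symmetric[OF assms] binomial_gbinomial)
  also have "\<dots> = (x gchoose (n - i)) * ((x - of_nat (n - i)) gchoose (n - (n - i)))"
    by (rule gbinomial_trinomial_revision) simp
  also have "\<dots> = ((x - of_nat n + of_nat i) gchoose i) * (x gchoose (n - i))"
    using assms by (simp add: of_nat_diff algebra_simps)
  finally show ?thesis ..
qed

text \<open>
  Choosing an \<open>n\<close>-subset of a \<open>(2n-1)\<close>-set together with an \<open>i\<close>-subset of it can be done in either
  order, so the quotient on the left is \<open>((2n-1-i) choose (n-i)) / ((2n-1) choose n)\<close>. The
  numerator is \<open>(-n) gchoose (n-i)\<close> up to sign; the denominator no longer depends on \<open>i\<close>.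
\<close>
lemma binomial_quotient_eq_gbinomial_minus:
  assumes "i \<le> n" "n > 0"
  shows "(- 1) ^ i * (of_nat (n choose i) * inverse (of_nat ((2 * n - 1) choose i)))
    = (- 1) ^ n * inverse (of_nat ((2 * n - 1) choose n)) * ((- of_nat n :: 'a :: field_char_0) gchoose (n - i))"
proof -
  have "((2 * n - 1) choose n) * (n choose i)
      = ((2 * n - 1) choose i) * ((2 * n - 1 - i) choose (n - i))"
    using assms by (intro choose_mult) auto
  hence *: "of_nat ((2 * n - 1) choose n) * of_nat (n choose i)
      = (of_nat ((2 * n - 1) choose i) * of_nat ((2 * n - 1 - i) choose (n - i)) :: 'a)"
    by (metis of_nat_mult)
  have "(of_nat (n - i) - (- of_nat n) - 1 :: 'a) = of_nat (2 * n - 1 - i)"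
    using assms by (simp add: of_nat_diff)
  hence neg: "((- of_nat n :: 'a) gchoose (n - i))
      = (- 1) ^ (n - i) * of_nat ((2 * n - 1 - i) choose (n - i))"
    by (subst gbinomial_negated_upper) (simp add: binomial_gbinomial)
  have sign: "(- 1 :: 'a) ^ n * (- 1) ^ (n - i) = (- 1) ^ i"
    using assms(1) by (simp add: minus_one_power_iff)
  have nz: "of_nat ((2 * n - 1) choose n) \<noteq> (0 :: 'a)" "of_nat ((2 * n - 1) choose i) \<noteq> (0 :: 'a)"
    using assms by auto
  have "of_nat (n choose i) * inverse (of_nat ((2 * n - 1) choose i))
      = inverse (of_nat ((2 * n - 1) choose n)) * (of_nat ((2 * n - 1 - i) choose (n - i)) :: 'a)"
    using * nz by (simp add: field_simps)
  thus ?thesis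
    unfolding neg sign[symmetric] by (simp add: ac_simps)
qed

lemma alternating_sum_binomial_square_quotient:
  assumes "n > 0"
  shows "(\<Sum>i\<le>n. (- 1) ^ i * of_nat (n choose i) ^ 2
    * inverse (of_nat ((2 * n - 1) choose i))) = (0 :: 'a :: field_char_0)"
proof -
  define c :: 'a where "c = (- 1) ^ n * inverse (of_nat ((2 * n - 1) choose n))"
  have "(\<Sum>i\<le>n. (- 1) ^ i * of_nat (n choose i) ^ 2 * inverse (of_nat ((2 * n - 1) choose i)))
      = (\<Sum>i\<le>n. c * ((of_nat n gchoose i) * ((- of_nat n :: 'a) gchoose (n - i))))"
  proof (rule sum.cong)
    fix i assume "i \<in> {..n}"
    hence "(- 1) ^ i * (of_nat (n choose i) * inverse (of_nat ((2 * n - 1) choose i)))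
        = c * ((- of_nat n :: 'a) gchoose (n - i))"
      using assms unfolding c_def by (intro binomial_quotient_eq_gbinomial_minus) auto
    thus "(- 1) ^ i * of_nat (n choose i) ^ 2 * inverse (of_nat ((2 * n - 1) choose i))
        = c * ((of_nat n gchoose i) * ((- of_nat n :: 'a) gchoose (n - i)))"
      by (simp add: binomial_gbinomial power2_eq_square mult_ac)
  qed simp
  also have "\<dots> = c * ((of_nat n + (- of_nat n)) gchoose n)"
    by (simp only: gbinomial_Vandermonde atMost_atLeast0 flip: sum_distrib_left)
  also have "\<dots> = 0"
    using assms by (cases n) simp_all
  finally show ?thesis .
qed

theorem mainTheorem4:
  fixes x :: "'a :: field_char_0" and n :: nat
  shows "x gchoose n =
    (\<Sum>i = 1..n. ((x - of_nat n + of_nat i) gchoose i) * (x gchoose (n - i))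
        * of_nat (n choose i) * inverse (of_nat ((2 * n - 1) choose i)) * (- 1) ^ (i + 1))
    + of_bool (n = 0)"
proof (cases "n = 0")
  case True
  thus ?thesis by simp
next
  case False
  define g :: "nat \<Rightarrow> 'a" where
    "g i = (- 1) ^ i * of_nat (n choose i) ^ 2 * inverse (of_nat ((2 * n - 1) choose i))" for i
  have "(\<Sum>i\<le>n. g i) = 0"
    using False unfolding g_def by (intro alternating_sum_binomial_square_quotient) simp
  moreover have "(\<Sum>i\<le>n. g i) = g 0 + (\<Sum>i = 1..n. g i)"
    by (simp add: atMost_atLeast0 sum.atLeast_Suc_atMost)
  ultimately have g: "(\<Sum>i = 1..n. g i) = - 1"
    by (simp add: g_def add_eq_0_iff)
  have "(\<Sum>i = 1..n. ((x - of_nat n + of_nat i) gchoose i) * (x gchoose (n - i))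
        * of_nat (n choose i) * inverse (of_nat ((2 * n - 1) choose i)) * (- 1) ^ (i + 1))
      = (\<Sum>i = 1..n. - (x gchoose n) * g i)"
  proof (rule sum.cong)
    fix i assume "i \<in> {1..n}"
    hence "i \<le> n" by simp
    thus "((x - of_nat n + of_nat i) gchoose i) * (x gchoose (n - i))
        * of_nat (n choose i) * inverse (of_nat ((2 * n - 1) choose i)) * (- 1) ^ (i + 1)
      = - (x gchoose n) * g i"
      by (simp only: gbinomial_product_eq_gbinomial_times_binomial)
        (simp add: g_def power2_eq_square mult_ac)
  qed simp
  also have "\<dots> = x gchoose n"
    by (simp only: g flip: sum_distrib_left) simp
  finally show ?thesis
    using False by simp
qed

end
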